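(* For every real number $x$ one has, as Laurent series in $q$, $$[x+1]_{q}=q[x]_{q}+1,$$ and, for every real $x\neq 0$, $$\left[-\frac{1}{x}\right]_{q}=-q^{-1}\frac{1}{[x]_{q}}.$$
   Context: $q$ is a formal variable. For $n\in\mathbb{Z}$, $[n]_q:=\frac{1-q^n}{1-q}$ (so $[n]_q=1+q+\dots+q^{n-1}$ for $n>0$, $[0]_q=0$, $[-n]_q=-q^{-1}-\dots-q^{-n}$ for $n>0$). Every rational number $\frac{r}{s}$ has a unique continued fraction expansion $\frac rs=a_1+\cfrac{1}{a_2+\cfrac{1}{\ddots+\cfrac{1}{a_{2m}}}}$ of even length with $a_1\in\mathbb{Z}$ and $a_i\geq 1$ for $i\ge2$. Its $q$-deformation is the rational function $$\left[\tfrac rs\right]_q:=[a_1]_{q} + \cfrac{q^{a_{1}}}{[a_2]_{q^{-1}} + \cfrac{q^{-a_{2}}}{[a_{3}]_{q} +\cfrac{q^{a_{3}}}{\ddots+\cfrac{q^{-a_{2m-2}}}{[a_{2m-1}]_q+\cfrac{q^{a_{2m-1}}}{[a_{2m}]_{q^{-1}}}}}}},$$ regarded as a Laurent series in $q$ (finitely many negative powers). It is known that if $x$ is irrational and $(x_n)$ is any sequence of rationals converging to $x$, then for each $k$ the coefficient of $q^k$ in $[x_n]_q$ is eventually constant, with an integer limit $\chi_k$ independent of the chosen sequence, and $\chi_k=0$ for $k<-N$ for some $N\ge0$, $\chi_{-N}=\pm1$; the $q$-deformation of the irrational $x$ is the Laurent series $[x]_q:=\sum_{k\ge -N}\chi_kq^k$.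 *)

theory Defs
  imports Complex_Main "HOL-Computational_Algebra.Formal_Laurent_Series"
begin

(* Stated over an arbitrary field so that both q and inverse q can be substituted. *)
definition q_int :: "'a::field \<Rightarrow> int \<Rightarrow> 'a" where
  "q_int q n = (1 - q powi n) / (1 - q)"

fun cfrac :: "int list \<Rightarrow> real" where
  "cfrac [] = 0"
| "cfrac [a] = of_int a"
| "cfrac (a # b # as) = of_int a + 1 / cfrac (b # as)"

definition is_even_cfrac :: "int list \<Rightarrow> real \<Rightarrow> bool" where
  "is_even_cfrac as x \<longleftrightarrow>
     as \<noteq> [] \<and> even (length as) \<and> (\<forall>a \<in> set (tl as). a \<ge> 1) \<and> cfrac as = x"

(* Passing to the next partial quotient replaces q by inverse q, which turns both
   [a]_q into [a]_{1/q} and the numerator q^a into q^(-a). *)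
fun q_cfrac :: "'a::field \<Rightarrow> int list \<Rightarrow> 'a" where
  "q_cfrac q [] = 0"
| "q_cfrac q [a] = q_int q a"
| "q_cfrac q (a # b # as) = q_int q a + q powi a / q_cfrac (inverse q) (b # as)"

(* The rational function is evaluated directly in the field of Laurent series over the
   rationals, at q = fls_X; this is its Laurent expansion at q = 0.
   Only meaningful for rational x. *)
definition q_rational :: "real \<Rightarrow> rat fls" where
  "q_rational x = q_cfrac fls_X (THE as. is_even_cfrac as x)"

definition stabilizes_to :: "(nat \<Rightarrow> rat fls) \<Rightarrow> rat fls \<Rightarrow> bool" where
  "stabilizes_to F G \<longleftrightarrow>
     (\<forall>k::int. eventually (\<lambda>n. fls_nth (F n) k = fls_nth G k) sequentially)"

(* For irrational x: the Laurent series to which the deformations of every sequence of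
   rationals converging to x stabilize. *)
definition q_real :: "real \<Rightarrow> rat fls" where
  "q_real x =
     (if x \<in> \<rat> then q_rational x
      else (THE G. \<forall>xs. (\<forall>n. xs n \<in> \<rat>) \<and> xs \<longlonglongrightarrow> x
                    \<longrightarrow> stabilizes_to (\<lambda>n. q_rational (xs n)) G))"

end

theory Submission
  imports Defs
begin

text \<open>
  The positive rationals are generated from 1 by the maps x \<mapsto> x + 1 and x \<mapsto> x / (1 + x).
  On even continued fractions these maps act on the leading entries only, so their deformations
  are V \<mapsto> q V + 1 and V \<mapsto> q V / (1 + q V); the relation for -1/x on rationals follows by
  induction along this generation. Both deformed maps are contractions of the power series
  for the q-adic metric. Pulling an irrational back n times along the two maps therefore gives a
  neighbourhood on whose rationals the deformation is constant modulo q^n. This yields the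
  limits, and both relations pass to them.
\<close>

section \<open>Generation of the positive rationals from 1\<close>

lemma rat_pos_induct [consumes 2, case_names one plus_one over]:
  fixes x :: real
  assumes "x \<in> \<rat>" "x > 0"
    and one: "P 1"
    and plus: "\<And>x. x \<in> \<rat> \<Longrightarrow> x > 0 \<Longrightarrow> P x \<Longrightarrow> P (x + 1)"
    and over: "\<And>x. x \<in> \<rat> \<Longrightarrow> x > 0 \<Longrightarrow> P x \<Longrightarrow> P (x / (1 + x))"
  shows "P x"
proof -
  \<comment> \<open>This is the subtractive Euclidean algorithm, run by induction on m + n.
    Fractions are not assumed reduced, so the recursion ends at m = n rather than at 1/1.\<close>
  have main: "P (real m / real n)" if "m > 0" "n > 0" for m n :: nat
    using that
  proof (induction "m + n" arbitrary: m n rule: less_induct)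
    case less
    have rat: "real i / real j \<in> \<rat>" for i j by simp
    consider "m = n" | "m > n" | "m < n" by linarith
    then show ?case
    proof cases
      case 1
      then show ?thesis using one less.prems by simp
    next
      case 2
      then have "P (real (m - n) / real n + 1)"
        using less.hyps[of "m - n" n] less.prems by (intro plus[OF rat]) auto
      then show ?thesis
        using 2 less.prems by (simp add: field_simps of_nat_diff)
    next
      case 3
      then obtain k where k: "n = m + k" "k > 0" using less_imp_add_positive by blast
      let ?y = "real m / real k"
      have "P (?y / (1 + ?y))"
        using k less.hyps[of m k] less.prems by (intro over[OF rat]) auto
      moreover have "?y / (1 + ?y) = real m / real n"
        using k less.prems by (simp add: divide_simps)
      ultimately show ?thesis by (simp only:)
    qed
  qed
  obtain m n where "n \<noteq> 0" "\<bar>x\<bar> = real m / real n"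
    using Rats_abs_nat_div_natE[OF assms(1)] by metis
  then show ?thesis
    using main[of m n] assms(2) by (cases "m = 0") auto
qed

section \<open>Even continued fractions\<close>

text \<open>Equality is possible only for the single entry 1, whose length is odd; this is where
  parity enters the uniqueness of expansions.\<close>

lemma cfrac_ge_1:
  assumes "as \<noteq> []" "\<forall>a \<in> set as. a \<ge> 1"
  shows "cfrac as \<ge> 1 \<and> (even (length as) \<longrightarrow> cfrac as > 1)"
  using assms
proof (induction as rule: cfrac.induct)
  case (3 a b as)
  then have "1 / cfrac (b # as) > 0" by simp
  moreover have "real_of_int a \<ge> 1" using 3 by simp
  ultimately show ?case unfolding cfrac.simps by linarith
qed auto

text \<open>The bounds recover the first entry from the value: it is the ceiling minus one for even
  length, where the tail may equal 1, and, by \<open>odd_cfrac_bounds\<close>, the floor for odd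
  length, where the tail exceeds 1.\<close>

lemma even_cfrac_bounds:
  assumes "odd (length (b # as))" "\<forall>c \<in> set (b # as). c \<ge> 1"
  shows "of_int a < cfrac (a # b # as)" "cfrac (a # b # as) \<le> of_int a + 1"
  using cfrac_ge_1[of "b # as"] assms by (auto simp: field_simps)

lemma odd_cfrac_bounds:
  assumes "even (length (b # as))" "\<forall>c \<in> set (b # as). c \<ge> 1"
  shows "of_int a < cfrac (a # b # as)" "cfrac (a # b # as) < of_int a + 1"
  using cfrac_ge_1[of "b # as"] assms by (auto simp: field_simps)

text \<open>Fixing the parity rules out the one ambiguity, a last entry c + 1 split into c, 1. Both
  parities are treated together because removing the first entry changes the parity.\<close>

lemma cfrac_inject:
  assumes "as \<noteq> []" "bs \<noteq> []" "even (length as) = even (length bs)"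
    and "\<forall>a \<in> set (tl as). a \<ge> 1" "\<forall>b \<in> set (tl bs). b \<ge> 1" "cfrac as = cfrac bs"
  shows "as = bs"
  using assms
proof (induction as arbitrary: bs rule: cfrac.induct)
  case (2 a)
  show ?case
  proof (cases bs rule: cfrac.cases)
    \<comment> \<open>By parity the tail of \<open>bs\<close> has even length, so its value would
      lie strictly between two consecutive integers.\<close>
    case (3 c d ds)
    then have "of_int c < real_of_int a" "real_of_int a < of_int c + 1"
      using 2 odd_cfrac_bounds[of d ds c] by auto
    then have "c < a" "a < c + 1" by linarith+
    then show ?thesis by simp
  qed (use 2 in auto)
next
  case (3 a b as)
  show ?case
  proof (cases bs rule: cfrac.cases)
    case (2 c)
    then have "of_int a < real_of_int c" "real_of_int c < of_int a + 1"
      using 3 odd_cfrac_bounds[of b as a] by auto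
    then have "a < c" "c < a + 1" by linarith+
    then show ?thesis by simp
  next
    case bs: (3 c d ds)
    have "a = c"
    proof (cases "even (length as)")
      case True
      then have "of_int a < cfrac (a # b # as)" "cfrac (a # b # as) \<le> of_int a + 1"
        using even_cfrac_bounds[of b as a] "3.prems"(4) by auto
      moreover have "of_int c < cfrac bs" "cfrac bs \<le> of_int c + 1"
        using even_cfrac_bounds[of d ds c] "3.prems"(3,5) True bs by auto
      ultimately show ?thesis unfolding "3.prems"(6) by linarith
    next
      case False
      then have "of_int a < cfrac (a # b # as)" "cfrac (a # b # as) < of_int a + 1"
        using odd_cfrac_bounds[of b as a] "3.prems"(4) by auto
      moreover have "of_int c < cfrac bs" "cfrac bs < of_int c + 1"
        using odd_cfrac_bounds[of d ds c] "3.prems"(3,5) False bs by auto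
      ultimately show ?thesis unfolding "3.prems"(6) by linarith
    qed
    moreover from this have "cfrac (b # as) = cfrac (d # ds)"
      using 3 bs by simp
    then have "b # as = d # ds"
      using 3 bs by (intro "3.IH") auto
    ultimately show ?thesis using bs by simp
  qed (use 3 in simp)
qed auto

lemma is_even_cfrac_unique:
  "is_even_cfrac as x \<Longrightarrow> is_even_cfrac bs x \<Longrightarrow> as = bs"
  using cfrac_inject[of as bs] by (auto simp: is_even_cfrac_def)

lemma is_even_cfracE:
  assumes "is_even_cfrac as x"
  obtains a b cs where "as = a # b # cs" "even (length cs)" "\<forall>c \<in> set (b # cs). c \<ge> 1"
    "of_int a < x" "x \<le> of_int a + 1" "cfrac (b # cs) \<ge> 1" "x = of_int a + 1 / cfrac (b # cs)"
proof (cases as rule: cfrac.cases)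
  case (3 a b cs)
  then show thesis
    using assms even_cfrac_bounds[of b cs a] cfrac_ge_1[of "b # cs"]
    by (intro that[of a b cs]) (auto simp: is_even_cfrac_def)
qed (use assms in \<open>auto simp: is_even_cfrac_def\<close>)

lemma is_even_cfrac_plus_of_int:
  assumes "is_even_cfrac (a # as) x"
  shows "is_even_cfrac ((a + i) # as) (x + of_int i)"
  using assms by (cases as) (auto simp: is_even_cfrac_def)

text \<open>Since x / (1 + x) = 1 / (1 + 1 / x), two entries are added in front and the length stays
  even. The old first entry becomes an inner one, hence the condition on \<open>a\<close>.\<close>

lemma is_even_cfrac_over_Cons:
  assumes "is_even_cfrac (a # as) x" "a \<ge> 1"
  shows "is_even_cfrac (0 # 1 # a # as) (x / (1 + x))"
proof -
  have "of_int a < x" using assms(1) by (auto elim: is_even_cfracE)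
  then have "x > 0" using assms(2) by linarith
  then show ?thesis using assms by (auto simp: is_even_cfrac_def field_simps)
qed

text \<open>With leading entry 0, prepending 0, 1 would create an inner 0. Instead x = 1 / t goes to
  1 / (t + 1), which raises the second entry.\<close>

lemma is_even_cfrac_over_0:
  assumes "is_even_cfrac (0 # b # as) x"
  shows "is_even_cfrac (0 # (b + 1) # as) (x / (1 + x))"
proof -
  have "cfrac ((b + 1) # as) = cfrac (b # as) + 1" by (cases as) auto
  moreover have "cfrac (b # as) \<ge> 1" "x = 1 / cfrac (b # as)"
    using assms by (auto elim!: is_even_cfracE)
  moreover from this have "x > 0" by simp
  ultimately show ?thesis
    using assms by (auto simp: is_even_cfrac_def field_simps)
qed

lemma is_even_cfrac_exists:
  assumes "x \<in> \<rat>"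
  shows "\<exists>as. is_even_cfrac as x"
proof -
  have pos: "\<exists>as. is_even_cfrac as x" if "x \<in> \<rat>" "x > 0" for x
    using that
  proof (induction rule: rat_pos_induct)
    case one
    show ?case by (intro exI[of _ "[0, 1]"]) (simp add: is_even_cfrac_def)
  next
    case (plus_one x)
    then obtain a b cs where "is_even_cfrac (a # b # cs) x" by (metis is_even_cfracE)
    from is_even_cfrac_plus_of_int[OF this, of 1] show ?case by auto
  next
    case (over x)
    then obtain a b cs where as: "is_even_cfrac (a # b # cs) x" and "x \<le> of_int a + 1"
      by (metis is_even_cfracE)
    then have "a = 0 \<or> a \<ge> 1" using over.hyps by linarith
    then show ?case
      using as is_even_cfrac_over_Cons is_even_cfrac_over_0 by blast
  qed
  define m where "m = 1 - \<lfloor>x\<rfloor>"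
  have "x + of_int m > 0" unfolding m_def by linarith
  then obtain a b cs where "is_even_cfrac (a # b # cs) (x + of_int m)"
    using pos[of "x + of_int m"] assms by (metis Rats_add Rats_of_int is_even_cfracE)
  from is_even_cfrac_plus_of_int[OF this, of "- m"] show ?thesis by auto
qed

section \<open>Order of vanishing\<close>

text \<open>Stated through coefficients because \<open>fls_subdegree\<close> of 0 is 0 by
  convention, whereas 0 must count as having infinite order.\<close>

definition fls_order_ge :: "int \<Rightarrow> 'a::zero fls \<Rightarrow> bool" where
  "fls_order_ge n F \<longleftrightarrow> (\<forall>k<n. fls_nth F k = 0)"

lemma fls_order_ge_iff: "fls_order_ge n F \<longleftrightarrow> F = 0 \<or> n \<le> fls_subdegree F"
  unfolding fls_order_ge_def
  by (metis fls_eq0_below_subdegree fls_subdegree_geI leD le_less_linear nth_fls_subdegree_nonzero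
      order_less_le_trans fls_zero_nth)

lemma fls_order_ge_mono: "fls_order_ge n F \<Longrightarrow> m \<le> n \<Longrightarrow> fls_order_ge m F"
  by (auto simp: fls_order_ge_def)

lemma fls_order_ge_add:
  "fls_order_ge n F \<Longrightarrow> fls_order_ge n G \<Longrightarrow> fls_order_ge n (F + G :: 'a::monoid_add fls)"
  by (simp add: fls_order_ge_def)

lemma fls_order_ge_diff:
  "fls_order_ge n F \<Longrightarrow> fls_order_ge n G \<Longrightarrow> fls_order_ge n (F - G :: 'a::group_add fls)"
  by (simp add: fls_order_ge_def)

lemma fls_order_ge_mult:
  "fls_order_ge m F \<Longrightarrow> fls_order_ge n G \<Longrightarrow> fls_order_ge (m + n) (F * G :: 'a::field fls)"
  by (cases "F = 0"; cases "G = 0") (auto simp: fls_order_ge_iff)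

lemma fls_order_ge_X: "fls_order_ge 1 fls_X"
  by (simp add: fls_order_ge_def)

lemma fls_order_ge_X_inverse: "fls_order_ge (- 1) (inverse fls_X :: 'a::field fls)"
  by (simp add: fls_order_ge_iff)

lemma fls_order_ge_all_imp_0: "(\<And>n. fls_order_ge n F) \<Longrightarrow> F = 0"
  by (metis fls_order_ge_iff less_add_one linorder_not_le)

text \<open>The constant coefficient is 1, so the series is a unit of the power series ring.\<close>

lemma one_plus_X_mult:
  fixes A :: "'a::field fls"
  assumes "fls_order_ge 0 A"
  shows "1 + fls_X * A \<noteq> 0" "fls_order_ge 0 (1 / (1 + fls_X * A))"
proof -
  have "fls_order_ge 1 (fls_X * A)"
    using fls_order_ge_mult[OF fls_order_ge_X assms] by simp
  then have nth: "fls_nth (1 + fls_X * A) k = (if k = 0 then 1 else 0)" if "k \<le> 0" for k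
    using that by (simp add: fls_order_ge_def del: fls_X_times_conv_shift)
  from nth[of 0] show "1 + fls_X * A \<noteq> 0" by (metis fls_zero_nth order_refl zero_neq_one)
  have "fls_subdegree (1 + fls_X * A) = 0"
    using nth by (intro fls_subdegree_eqI) (auto simp del: fls_X_times_conv_shift)
  then show "fls_order_ge 0 (1 / (1 + fls_X * A))"
    by (simp add: fls_order_ge_iff divide_inverse del: fls_X_times_conv_shift)
qed

section \<open>The modular relations on rationals\<close>

lemma q_int_plus_1:
  assumes "q \<noteq> 0" "q \<noteq> (1::'a::field)"
  shows "q_int q (n + 1) = q * q_int q n + 1"
  using assms by (simp add: q_int_def power_int_add field_simps)

text \<open>The first term and the first numerator both absorb the factor q. The base is kept
  general because the rule is also applied at \<open>inverse q\<close>, to the second entry.\<close>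

lemma q_cfrac_plus_1:
  assumes "q \<noteq> 0" "q \<noteq> (1::'a::field)"
  shows "q_cfrac q ((a + 1) # as) = q * q_cfrac q (a # as) + 1"
  using assms by (cases as) (auto simp: q_int_plus_1 power_int_add distrib_left)

text \<open>Two levels down the base has returned from \<open>inverse q\<close> to q, so the old
  fraction V reappears in 1 / (1 + q^(-1) / V). If 1 + q V vanishes, both sides are 0 by the
  convention for division by zero.\<close>

lemma q_cfrac_over_Cons:
  assumes "q \<noteq> 0" "q \<noteq> (1::'a::field)" "q_cfrac q (a # as) \<noteq> 0"
  shows "q_cfrac q (0 # 1 # a # as) =
    q * q_cfrac q (a # as) / (1 + q * q_cfrac q (a # as))"
  using assms by (simp add: q_int_def field_simps)

lemma q_cfrac_over_0:
  assumes "q \<noteq> 0" "q \<noteq> (1::'a::field)" "q_cfrac q (0 # b # as) \<noteq> 0"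
  shows "q_cfrac q (0 # (b + 1) # as) =
    q * q_cfrac q (0 # b # as) / (1 + q * q_cfrac q (0 # b # as))"
proof -
  have "1 / (inverse q * W + 1) = q * (1 / W) / (1 + q * (1 / W))" if "W \<noteq> 0" for W
    using assms that by (simp add: field_simps)
  then show ?thesis
    using assms by (simp add: q_int_def q_cfrac_plus_1)
qed

lemma fls_X_neq_1: "(fls_X :: 'a::zero_neq_one fls) \<noteq> 1"
proof
  assume "(fls_X :: 'a fls) = 1"
  then have "fls_nth (fls_X :: 'a fls) 0 = fls_nth 1 0" by simp
  then show False by simp
qed

lemma q_rational_eq:
  "is_even_cfrac as x \<Longrightarrow> q_rational x = q_cfrac fls_X as"
  unfolding q_rational_def using is_even_cfrac_unique by (metis the_equality)

lemma q_rational_1: "q_rational 1 = 1"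
proof -
  have "is_even_cfrac [0, 1] 1" by (simp add: is_even_cfrac_def)
  then show ?thesis by (simp add: q_rational_eq q_int_def fls_X_neq_1)
qed

lemma q_rational_plus_1:
  assumes "x \<in> \<rat>"
  shows "q_rational (x + 1) = fls_X * q_rational x + 1"
proof -
  obtain a b cs where as: "is_even_cfrac (a # b # cs) x"
    using is_even_cfrac_exists[OF assms] by (metis is_even_cfracE)
  from is_even_cfrac_plus_of_int[OF this, of 1]
  have "is_even_cfrac ((a + 1) # b # cs) (x + 1)" by simp
  then show ?thesis
    using as q_cfrac_plus_1[of fls_X a "b # cs"] fls_X_neq_1 by (metis fls_X_nonzero q_rational_eq)
qed

lemma q_rational_over:
  assumes "x \<in> \<rat>" "x > 0" "q_rational x \<noteq> 0"
  shows "q_rational (x / (1 + x)) = fls_X * q_rational x / (1 + fls_X * q_rational x)"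
proof -
  obtain a b cs where as: "is_even_cfrac (a # b # cs) x" and "x \<le> of_int a + 1"
    using is_even_cfrac_exists[OF assms(1)] by (metis is_even_cfracE)
  then consider "a \<ge> 1" | "a = 0" using assms(2) by linarith
  then show ?thesis
  proof cases
    case 1
    show ?thesis
      using assms(3) q_cfrac_over_Cons[of fls_X a "b # cs"] fls_X_neq_1
      unfolding q_rational_eq[OF as] q_rational_eq[OF is_even_cfrac_over_Cons[OF as 1]] by force
  next
    case 2
    show ?thesis
      using assms(3) q_cfrac_over_0[of fls_X b cs] fls_X_neq_1
      unfolding q_rational_eq[OF as] q_rational_eq[OF is_even_cfrac_over_0[OF as[unfolded 2]]] 2
      by force
  qed
qed

text \<open>The two claims are proved together: nonvanishing allows \<open>q_rational_over\<close>,
  and the order bound makes 1 + q V a unit.\<close>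

lemma q_rational_pos:
  assumes "x \<in> \<rat>" "x > 0"
  shows "q_rational x \<noteq> 0 \<and> fls_order_ge 0 (q_rational x)"
  using assms
proof (induction rule: rat_pos_induct)
  case one
  show ?case by (simp add: q_rational_1 fls_order_ge_iff)
next
  case (plus_one x)
  have "fls_order_ge 1 (fls_X * q_rational x)"
    using fls_order_ge_mult[OF fls_order_ge_X] plus_one.IH by force
  then have "fls_order_ge 0 (fls_X * q_rational x + 1)"
    by (intro fls_order_ge_add) (auto intro: fls_order_ge_mono simp: fls_order_ge_iff)
  moreover have "fls_X * q_rational x + 1 \<noteq> 0"
    using one_plus_X_mult(1)[of "q_rational x"] plus_one.IH by (simp add: add.commute)
  ultimately show ?case using plus_one.hyps by (simp add: q_rational_plus_1)
next
  case (over x)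
  have "fls_order_ge 1 (fls_X * q_rational x)"
    using fls_order_ge_mult[OF fls_order_ge_X] over.IH by force
  from fls_order_ge_mult[OF this one_plus_X_mult(2)[of "q_rational x"]]
  have "fls_order_ge 0 (fls_X * q_rational x / (1 + fls_X * q_rational x))"
    using over.IH by (auto elim: fls_order_ge_mono simp del: fls_X_times_conv_shift)
  then show ?case
    using over q_rational_over[of x] one_plus_X_mult(1)[of "q_rational x"] by auto
qed

text \<open>Two identities drive the induction: 1 - 1 / (x + 1) = x / (1 + x), which settles x + 1
  through \<open>q_rational_over\<close>, and 1 - (1 + x) / x = -1 / x, which reduces x / (1 + x) to
  the induction hypothesis at x.\<close>

lemma q_rational_inverse_pos:
  assumes "x \<in> \<rat>" "x > 0"
  shows "q_rational (- (1 / x)) * q_rational x = - inverse fls_X"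
  using assms
proof (induction rule: rat_pos_induct)
  case one
  \<comment> \<open>The shift relation at 0 and the value 1 at 1 force the deformation of 0 to
    vanish; the shift relation at -1 then gives that of -1.\<close>
  have "q_rational 0 = fls_X * q_rational (-1) + 1" 
    using q_rational_plus_1[of "-1"] by simp
  then have "fls_X * q_rational (-1) + 1 = 0"
    using q_rational_plus_1[of 0] by (simp add: q_rational_1 del: fls_X_times_conv_shift)
  then have "q_rational (-1) = - inverse fls_X"
    using fls_X_nonzero by (metis add_eq_0_iff2 inverse_unique minus_minus minus_mult_right)
  then show ?case by (simp add: q_rational_1)
next
  case (plus_one x)
  let ?V = "q_rational x"
  have nz: "1 + fls_X * ?V \<noteq> 0" "?V \<noteq> 0"
    using plus_one.hyps q_rational_pos one_plus_X_mult by blast+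
  have "- (1 / (x + 1)) + 1 = x / (1 + x)"
    using plus_one.hyps by (simp add: field_simps)
  then have "fls_X * ?V / (1 + fls_X * ?V) = fls_X * q_rational (- (1 / (x + 1))) + 1"
    using q_rational_plus_1[of "- (1 / (x + 1))"] q_rational_over[of x] plus_one.hyps nz by simp
  moreover have "W * (q * V + 1) = - inverse q"
    if "q * V / (1 + q * V) = q * W + 1" "1 + q * V \<noteq> 0" "q \<noteq> 0" for q V W :: "rat fls"
  proof -
    have "q * (W * (q * V + 1)) = - 1"
      using that(1,2) by (simp add: field_simps add_eq_0_iff)
    with that(3) show ?thesis by (simp add: field_simps add_eq_0_iff)
  qed
  ultimately show ?case
    unfolding q_rational_plus_1[OF plus_one.hyps(1)] using nz fls_X_nonzero by blast
next
  case (over x)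
  let ?V = "q_rational x" and ?W = "q_rational (- (1 / x))"
  have nz: "1 + fls_X * ?V \<noteq> 0" "?V \<noteq> 0"
    using over.hyps q_rational_pos one_plus_X_mult by blast+
  have "- (1 / (x / (1 + x))) + 1 = - (1 / x)"
    using over.hyps by (simp add: field_simps)
  then have "?W = fls_X * q_rational (- (1 / (x / (1 + x)))) + 1"
    using q_rational_plus_1[of "- (1 / (x / (1 + x)))"] over.hyps by simp
  moreover have "W' * (q * V / (1 + q * V)) = - inverse q"
    if "W = q * W' + 1" "W * V = - inverse q" "1 + q * V \<noteq> 0" "q \<noteq> 0" for q V W W' :: "rat fls"
  proof -
    have "q * (W * V) = - 1" using that(2,4) by simp
    then have "q * (W' * (q * V)) = - (1 + q * V)"
      using that(1) by (simp add: algebra_simps add_eq_0_iff)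
    with that(3,4) show ?thesis by (simp add: field_simps)
  qed
  ultimately show ?case
    unfolding q_rational_over[OF over.hyps nz(2)] using nz over.IH fls_X_nonzero by blast
qed

lemma q_rational_inverse:
  assumes "x \<in> \<rat>" "x \<noteq> 0"
  shows "q_rational (- (1 / x)) * q_rational x = - inverse fls_X"
proof (cases "x > 0")
  case True
  with assms(1) show ?thesis by (rule q_rational_inverse_pos)
next
  case False
  then show ?thesis
    using q_rational_inverse_pos[of "- (1 / x)"] assms by (simp add: mult.commute)
qed

section \<open>Stabilization at irrationals\<close>

lemma eventually_nhds_imp_ex_rat:
  assumes "eventually P (nhds (x::real))"
  shows "\<exists>y\<in>\<rat>. P y"
proof -
  obtain d where "d > 0" "\<And>y. dist y x < d \<Longrightarrow> P y"
    using assms by (auto simp: eventually_nhds_metric)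
  moreover obtain y where "y \<in> \<rat>" "x < y" "y < x + d"
    using Rats_dense_in_real[of x "x + d"] \<open>d > 0\<close> by auto
  ultimately show ?thesis by (intro bexI[of _ y]) (auto simp: dist_real_def)
qed

text \<open>Neighbourhoods replace the sequences in the definition of \<open>q_real\<close>, so that
  approximations can be transported along continuous maps. Only the coefficients of A below n
  matter.\<close>

definition q_approx :: "int \<Rightarrow> real \<Rightarrow> rat fls \<Rightarrow> bool" where
  "q_approx n x A \<longleftrightarrow> (\<forall>\<^sub>F y in nhds x. y \<in> \<rat> \<longrightarrow> fls_order_ge n (q_rational y - A))"

lemma q_approx_compose:
  assumes "q_approx n (f x) A" "isCont f x"
  shows "\<forall>\<^sub>F y in nhds x. f y \<in> \<rat> \<longrightarrow> fls_order_ge n (q_rational (f y) - A)"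
proof -
  have "filterlim f (nhds (f x)) (nhds x)"
    using assms(2) by (simp add: isCont_def tendsto_at_iff_tendsto_nhds)
  from eventually_compose_filterlim[OF assms(1)[unfolded q_approx_def] this] show ?thesis .
qed

text \<open>The factor q gained by the shift raises the precision by one;
  \<open>q_approx_plus_1\<close> inverts this and loses one.\<close>

lemma q_approx_minus_1:
  assumes "q_approx n (x - 1) A"
  shows "q_approx (n + 1) x (fls_X * A + 1)"
proof -
  have "\<forall>\<^sub>F y in nhds x. y - 1 \<in> \<rat> \<longrightarrow> fls_order_ge n (q_rational (y - 1) - A)"
    by (rule q_approx_compose) (use assms in simp_all)
  then show ?thesis
    unfolding q_approx_def
  proof (rule eventually_mono, intro impI)
    fix y :: real
    assume *: "y - 1 \<in> \<rat> \<longrightarrow> fls_order_ge n (q_rational (y - 1) - A)" and "y \<in> \<rat>"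
    then have "fls_order_ge (n + 1) (fls_X * (q_rational (y - 1) - A))"
      using fls_order_ge_mult[OF fls_order_ge_X] by (metis Rats_1 Rats_diff add.commute)
    moreover have "q_rational y = fls_X * q_rational (y - 1) + 1"
      using q_rational_plus_1[of "y - 1"] \<open>y \<in> \<rat>\<close> by simp
    ultimately show "fls_order_ge (n + 1) (q_rational y - (fls_X * A + 1))"
      by (simp add: algebra_simps del: fls_X_times_conv_shift)
  qed
qed

lemma q_approx_plus_1:
  assumes "q_approx n (x + 1) A"
  shows "q_approx (n - 1) x (inverse fls_X * (A - 1))"
proof -
  have "\<forall>\<^sub>F y in nhds x. y + 1 \<in> \<rat> \<longrightarrow> fls_order_ge n (q_rational (y + 1) - A)"
    by (rule q_approx_compose) (use assms in simp_all)
  then show ?thesis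
    unfolding q_approx_def
  proof (rule eventually_mono, intro impI)
    fix y :: real
    assume *: "y + 1 \<in> \<rat> \<longrightarrow> fls_order_ge n (q_rational (y + 1) - A)" and "y \<in> \<rat>"
    then have "fls_order_ge (n - 1) (inverse fls_X * (q_rational (y + 1) - A))"
      using fls_order_ge_mult[OF fls_order_ge_X_inverse, of n "q_rational (y + 1) - A"] by simp
    moreover have "inverse fls_X * (q_rational (y + 1) - A) =
        q_rational y - inverse fls_X * (A - 1)"
    proof -
      have "inverse q * (q * V + 1 - A) = V - inverse q * (A - 1)" if "q \<noteq> 0" for q V :: "rat fls"
        using that by (simp add: field_simps)
      then show ?thesis
        unfolding q_rational_plus_1[OF \<open>y \<in> \<rat>\<close>] using fls_X_nonzero by blast
    qed
    ultimately show "fls_order_ge (n - 1) (q_rational y - inverse fls_X * (A - 1))" by simp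
  qed
qed

text \<open>The images of V and A differ by q (V - A) / ((1 + q A) (1 + q V)), whose denominator is
  a unit, so the precision again rises by one. The map y / (1 - y) inverts z / (1 + z).\<close>

lemma q_approx_over:
  assumes "q_approx n (x / (1 - x)) A" "fls_order_ge 0 A" "0 < x" "x < 1"
  shows "q_approx (n + 1) x (fls_X * A / (1 + fls_X * A))"
proof -
  have "\<forall>\<^sub>F y in nhds x. y / (1 - y) \<in> \<rat> \<longrightarrow> fls_order_ge n (q_rational (y / (1 - y)) - A)"
    using assms by (intro q_approx_compose continuous_intros) auto
  moreover have "\<forall>\<^sub>F y in nhds x. y \<in> {0<..<1}"
    using assms by (intro eventually_nhds_in_open) auto
  ultimately show ?thesis
    unfolding q_approx_def
  proof (eventually_elim, intro impI)
    fix y :: real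
    let ?z = "y / (1 - y)"
    let ?V = "q_rational ?z"
    assume "?z \<in> \<rat> \<longrightarrow> fls_order_ge n (?V - A)" and y: "y \<in> {0<..<1}" "y \<in> \<rat>"
    then have d: "fls_order_ge n (?V - A)" by simp
    have z: "?z \<in> \<rat>" "?z > 0" "?z / (1 + ?z) = y" using y by (simp_all add: field_simps)
    have V: "?V \<noteq> 0" "fls_order_ge 0 ?V" using q_rational_pos z by auto
    have nz: "1 + fls_X * A \<noteq> 0" "1 + fls_X * ?V \<noteq> 0"
      using one_plus_X_mult(1) V(2) assms(2) by auto
    have "fls_order_ge ((1 + n) + (0 + 0))
        ((fls_X * (?V - A)) * ((1 / (1 + fls_X * A)) * (1 / (1 + fls_X * ?V))))"
      by (intro fls_order_ge_mult fls_order_ge_X d one_plus_X_mult V assms)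
    moreover have "q_rational y - fls_X * A / (1 + fls_X * A) =
        (fls_X * (?V - A)) * ((1 / (1 + fls_X * A)) * (1 / (1 + fls_X * ?V)))"
    proof -
      have "q * V / (1 + q * V) - q * A / (1 + q * A) =
          q * (V - A) * (1 / (1 + q * A) * (1 / (1 + q * V)))"
        if "1 + q * A \<noteq> 0" "1 + q * V \<noteq> 0" for q V :: "rat fls"
        using that by (simp add: diff_frac_eq) (simp add: algebra_simps)
      with nz q_rational_over[OF z(1,2) V(1)] show ?thesis unfolding z(3) by metis
    qed
    ultimately show "fls_order_ge (n + 1) (q_rational y - fls_X * A / (1 + fls_X * A))"
      by (simp add: add.commute)
  qed
qed

text \<open>Precision 0 is free: positive rationals deform to power series, so A = 0 works. Each
  pull-back to x - 1 or x / (1 - x) buys one order, and an irrational never reaches 1. The order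
  bound on A is carried along for \<open>q_approx_over\<close>.\<close>

lemma q_approx_exists_pos:
  assumes "x \<notin> \<rat>" "x > 0"
  shows "\<exists>A. fls_order_ge 0 A \<and> q_approx (int n) x A"
  using assms
proof (induction n arbitrary: x)
  case 0
  have "\<forall>\<^sub>F y in nhds x. y \<in> {0<..}"
    using 0 by (intro eventually_nhds_in_open) auto
  then have "q_approx 0 x 0"
    unfolding q_approx_def by eventually_elim (simp add: q_rational_pos)
  then show ?case by (intro exI[of _ 0]) (simp add: fls_order_ge_iff)
next
  case (Suc n)
  have "x \<noteq> 1" using Suc.prems by auto
  then consider "x > 1" | "x < 1" by linarith
  then show ?case
  proof cases
    case 1
    have "x - 1 \<notin> \<rat>" using Suc.prems Rats_add[of "x - 1" 1] by auto
    then obtain A where A: "fls_order_ge 0 A" "q_approx (int n) (x - 1) A"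
      using Suc.IH[of "x - 1"] 1 by auto
    have "fls_order_ge 0 (fls_X * A + 1)"
      using fls_order_ge_mult[OF fls_order_ge_X A(1)]
      by (intro fls_order_ge_add) (auto elim: fls_order_ge_mono simp: fls_order_ge_iff)
    with q_approx_minus_1[OF A(2)] show ?thesis by (auto simp: add.commute)
  next
    case 2
    have "x / (1 - x) \<notin> \<rat>"
    proof
      have "z / (1 + z) \<in> \<rat>" if "z \<in> \<rat>" for z :: real
        using that by simp
      moreover assume "x / (1 - x) \<in> \<rat>"
      ultimately have "(x / (1 - x)) / (1 + x / (1 - x)) \<in> \<rat>" .
      also have "(x / (1 - x)) / (1 + x / (1 - x)) = x" using 2 by (simp add: divide_simps)
      finally show False using Suc.prems by simp
    qed
    then obtain A where A: "fls_order_ge 0 A" "q_approx (int n) (x / (1 - x)) A"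
      using Suc.IH[of "x / (1 - x)"] 2 Suc.prems by auto
    have "fls_order_ge 0 (fls_X * A / (1 + fls_X * A))"
      using fls_order_ge_mult[OF fls_order_ge_mult[OF fls_order_ge_X A(1)] one_plus_X_mult(2)[OF A(1)]]
      by (auto elim: fls_order_ge_mono)
    with q_approx_over[OF A(2,1)] 2 Suc.prems show ?thesis by (auto simp: add.commute)
  qed
qed

lemma q_approx_mono: "q_approx n x A \<Longrightarrow> m \<le> n \<Longrightarrow> q_approx m x A"
  unfolding q_approx_def by (erule eventually_mono) (auto elim: fls_order_ge_mono)

lemma q_approx_exists:
  assumes "x \<notin> \<rat>"
  shows "\<exists>A. q_approx n x A"
proof -
  \<comment> \<open>Induction on the number of unit shifts that make x positive. Each shift back
    costs one order, hence precision n + 1 is requested at x + 1.\<close>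
  have shift: "\<exists>A. q_approx n x A" if "x \<notin> \<rat>" "x + real m > 0" for n m x
    using that
  proof (induction m arbitrary: n x)
    case 0
    then obtain A where "q_approx (int (nat n)) x A" using q_approx_exists_pos[of x "nat n"] by auto
    then have "q_approx n x A" by (rule q_approx_mono) simp
    then show ?case ..
  next
    case (Suc m)
    have "x + 1 \<notin> \<rat>" using Suc.prems Rats_diff[of "x + 1" 1] by auto
    then obtain A where "q_approx (n + 1) (x + 1) A"
      using Suc.IH[of "x + 1" "n + 1"] Suc.prems by (auto simp: algebra_simps)
    from q_approx_plus_1[OF this] show ?case by auto
  qed
  obtain m where "- x < real m" using reals_Archimedean2 by blast
  then show ?thesis using shift[of x m] assms by simp
qed

text \<open>By density some rational near x has a deformation close to both series at once.\<close>

lemma q_approx_diff: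
  assumes "q_approx m x A" "q_approx n x B"
  shows "fls_order_ge (min m n) (A - B)"
proof -
  have "\<forall>\<^sub>F y in nhds x. (y \<in> \<rat> \<longrightarrow> fls_order_ge m (q_rational y - A)) \<and>
      (y \<in> \<rat> \<longrightarrow> fls_order_ge n (q_rational y - B))"
    using assms unfolding q_approx_def by (rule eventually_conj)
  then obtain y where "fls_order_ge m (q_rational y - A)" "fls_order_ge n (q_rational y - B)"
    using eventually_nhds_imp_ex_rat by blast
  then have "fls_order_ge (min m n) ((q_rational y - B) - (q_rational y - A))"
    by (blast intro: fls_order_ge_diff fls_order_ge_mono min.cobounded1 min.cobounded2)
  then show ?thesis by simp
qed

section \<open>Existence and uniqueness of the limit series\<close>

lemma q_limit_exists:
  assumes "x \<notin> \<rat>"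
  shows "\<exists>G. \<forall>n. q_approx n x G"
proof -
  obtain A where A: "\<And>n. q_approx n x (A n)"
    using q_approx_exists[OF assms] by metis
  have agree: "fls_nth (A m) k = fls_nth (A n) k" if "k < m" "k < n" for m n k
    using q_approx_diff[OF A[of m] A[of n]] that by (auto simp: fls_order_ge_def)
  \<comment> \<open>Coefficient k is read from the approximation of order k + 1, the least order
    that determines it.\<close>
  define G where "G = Abs_fls (\<lambda>k. fls_nth (A (k + 1)) k)"
  have nth: "fls_nth G k = fls_nth (A (k + 1)) k" for k
    unfolding G_def
  \<comment> \<open>Negative coefficients are already determined by \<open>A 0\<close>, so the
    diagonal series has only finitely many of them.\<close>
  proof (rule nth_Abs_fls_lower_bound[of "min 0 (fls_subdegree (A 0))"], intro allI impI)
    fix k :: int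
    assume "k < min 0 (fls_subdegree (A 0))"
    then show "fls_nth (A (k + 1)) k = 0"
      using agree[of k "k + 1" 0] by simp
  qed
  have "q_approx n x G" for n
  proof -
    have "fls_order_ge n (A n - G)"
      unfolding fls_order_ge_def using agree[of _ n "_ + 1"] nth by simp
    then have "fls_order_ge n (q_rational y - G)" if "fls_order_ge n (q_rational y - A n)" for y
      using fls_order_ge_add[OF that] by fastforce
    with A[of n] show ?thesis
      unfolding q_approx_def by (auto elim: eventually_mono)
  qed
  then show ?thesis by blast
qed

lemma q_approx_imp_stabilizes_to:
  assumes "\<And>n. q_approx n x G" "\<forall>n. xs n \<in> \<rat>" "xs \<longlonglongrightarrow> x"
  shows "stabilizes_to (\<lambda>n. q_rational (xs n)) G"
  unfolding stabilizes_to_def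
proof
  fix k :: int
  have "\<forall>\<^sub>F n in sequentially. xs n \<in> \<rat> \<longrightarrow> fls_order_ge (k + 1) (q_rational (xs n) - G)"
    using eventually_compose_filterlim[OF assms(1)[unfolded q_approx_def] assms(3)] .
  then show "\<forall>\<^sub>F n in sequentially. fls_nth (q_rational (xs n)) k = fls_nth G k"
    by eventually_elim (use assms(2) in \<open>simp add: fls_order_ge_def\<close>)
qed

lemma stabilizes_to_unique:
  assumes "stabilizes_to F G" "stabilizes_to F H"
  shows "G = H"
proof (rule fls_eqI)
  fix k
  have "\<forall>\<^sub>F n in sequentially. fls_nth (F n) k = fls_nth G k \<and> fls_nth (F n) k = fls_nth H k"
    using assms unfolding stabilizes_to_def by (intro eventually_conj) auto
  then have "\<exists>n. fls_nth (F n) k = fls_nth G k \<and> fls_nth (F n) k = fls_nth H k"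
    using eventually_happens' sequentially_bot by blast
  then show "fls_nth G k = fls_nth H k" by auto
qed

lemma q_approx_q_real:
  assumes "x \<notin> \<rat>"
  shows "q_approx n x (q_real x)"
proof -
  obtain G where G: "\<And>n. q_approx n x G" using q_limit_exists[OF assms] by blast
  \<comment> \<open>A rational sequence converging to x is constructed because without one every
    series would satisfy the condition under \<open>THE\<close> vacuously.\<close>
  have "\<exists>y\<in>\<rat>. \<bar>y - x\<bar> < 1 / real (Suc n)" for n
    by (rule eventually_nhds_imp_ex_rat)
      (auto simp: eventually_nhds_metric dist_real_def intro!: exI[of _ "1 / real (Suc n)"])
  then obtain xs where xs: "\<And>n. xs n \<in> \<rat>" "\<And>n. \<bar>xs n - x\<bar> < 1 / real (Suc n)" by metis
  have "xs \<longlonglongrightarrow> x"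
  proof (rule LIM_zero_cancel, rule tendsto_0_le)
    show "\<forall>\<^sub>F n in sequentially. norm (xs n - x) \<le> norm (1 / real (Suc n)) * 1"
      using xs(2) by (intro always_eventually) (simp add: less_imp_le)
    show "(\<lambda>n. 1 / real (Suc n)) \<longlonglongrightarrow> 0"
      using LIMSEQ_inverse_real_of_nat by (simp add: inverse_eq_divide)
  qed
  with xs(1) have "(THE G. \<forall>xs. (\<forall>n. xs n \<in> \<rat>) \<and> xs \<longlonglongrightarrow> x
      \<longrightarrow> stabilizes_to (\<lambda>n. q_rational (xs n)) G) = G"
    using q_approx_imp_stabilizes_to[OF G] stabilizes_to_unique
    by (intro the_equality) blast+
  then have "q_real x = G" using assms by (simp add: q_real_def)
  with G show ?thesis by simp
qed

section \<open>The two relations for all real numbers\<close>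

lemma q_real_plus_1: "q_real (x + 1) = fls_X * q_real x + 1"
proof (cases "x \<in> \<rat>")
  case True
  then show ?thesis by (simp add: q_real_def q_rational_plus_1 del: fls_X_times_conv_shift)
next
  case False
  then have "x + 1 \<notin> \<rat>" using Rats_diff[of "x + 1" 1] by auto
  have "q_approx n (x + 1) (fls_X * q_real x + 1)" for n
    using q_approx_minus_1[of "n - 1" "x + 1"] q_approx_q_real[OF False] by simp
  then have "fls_order_ge n (q_real (x + 1) - (fls_X * q_real x + 1))" for n
    using q_approx_diff[OF q_approx_q_real[OF \<open>x + 1 \<notin> \<rat>\<close>, of n], of n] by simp
  then show ?thesis using fls_order_ge_all_imp_0 by fastforce
qed

text \<open>Passing to the limit in the product rather than in the quotient also yields
  that the deformation of an irrational number is nonzero.\<close>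

lemma q_real_inverse:
  assumes "x \<noteq> 0"
  shows "q_real (- (1 / x)) * q_real x = - inverse fls_X"
proof (cases "x \<in> \<rat>")
  case True
  then show ?thesis using assms by (simp add: q_real_def q_rational_inverse)
next
  case False
  let ?G = "q_real x" and ?H = "q_real (- (1 / x))"
  have irr: "- (1 / x) \<notin> \<rat>"
  proof
    assume "- (1 / x) \<in> \<rat>"
    then have "- (1 / - (1 / x)) \<in> \<rat>" by (metis Rats_1 Rats_divide Rats_minus_iff)
    then show False using False by simp
  qed
  \<comment> \<open>A common lower bound for the two orders, capped at 0 so that \<open>N\<close> <=
    \<open>k\<close> below.\<close>
  define N where "N = min 0 (min (fls_subdegree ?G) (fls_subdegree ?H))"
  have GH: "fls_order_ge N ?G" "fls_order_ge N ?H" by (auto simp: N_def fls_order_ge_iff)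
  have "fls_order_ge n (- inverse fls_X - ?H * ?G)" if "n \<ge> 0" for n
  proof -
    \<comment> \<open>Multiplying by a factor of order at least \<open>N\<close> can lose
      -\<open>N\<close> orders, so precision n - \<open>N\<close> leaves order n in the
      product.\<close>
    define k where "k = n - N"
    have "N \<le> k" using that by (simp add: k_def N_def)
    have "\<forall>\<^sub>F y in nhds x. y \<in> \<rat> \<longrightarrow> fls_order_ge k (q_rational y - ?G)"
      using q_approx_q_real[OF False] unfolding q_approx_def .
    moreover have "\<forall>\<^sub>F y in nhds x. - (1 / y) \<in> \<rat> \<longrightarrow>
        fls_order_ge k (q_rational (- (1 / y)) - ?H)"
      using assms by (intro q_approx_compose q_approx_q_real irr continuous_intros) auto
    moreover have "\<forall>\<^sub>F y in nhds x. y \<in> - {0}"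
      using assms by (intro eventually_nhds_in_open) auto
    ultimately have "\<forall>\<^sub>F y in nhds x. y \<noteq> 0 \<and> (y \<in> \<rat> \<longrightarrow> fls_order_ge k (q_rational y - ?G) \<and>
        fls_order_ge k (q_rational (- (1 / y)) - ?H))"
      by eventually_elim auto
    then obtain y where y: "y \<in> \<rat>" "y \<noteq> 0" "fls_order_ge k (q_rational y - ?G)"
        "fls_order_ge k (q_rational (- (1 / y)) - ?H)"
      using eventually_nhds_imp_ex_rat by blast
    let ?V = "q_rational y" and ?W = "q_rational (- (1 / y))"
    \<comment> \<open>\<open>?V\<close> inherits the order bound of \<open>?G\<close>, to which it
      is close.\<close>
    have "fls_order_ge N ((?V - ?G) + ?G)"
      using y(3) GH \<open>N \<le> k\<close> by (intro fls_order_ge_add) (auto elim: fls_order_ge_mono)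
    then have V: "fls_order_ge N ?V" by simp
    \<comment> \<open>The difference of the two products is split so that each summand pairs a small
      difference with a factor of order at least \<open>N\<close>.\<close>
    have "fls_order_ge (k + N) ((?W - ?H) * ?V + (?V - ?G) * ?H)"
      by (intro fls_order_ge_add fls_order_ge_mult y GH V)
    also have "(?W - ?H) * ?V + (?V - ?G) * ?H = ?W * ?V - ?H * ?G"
      by (simp add: algebra_simps)
    finally show ?thesis
      unfolding q_rational_inverse[OF y(1,2)] by (simp add: k_def)
  qed
  then have "fls_order_ge n (- inverse fls_X - ?H * ?G)" for n
    using fls_order_ge_mono[of "max 0 n" _ n] by (meson max.cobounded1 max.cobounded2)
  from fls_order_ge_all_imp_0[OF this] show ?thesis by simp
qed

theorem theorem1p1:
  shows "(\<forall>x::real. q_real (x + 1) = fls_X * q_real x + 1) \<and>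
         (\<forall>x::real. x \<noteq> 0 \<longrightarrow>
            q_real x \<noteq> 0 \<and> q_real (- (1 / x)) = - (inverse fls_X) * (1 / q_real x))"
proof (intro conjI allI impI)
  show "q_real (x + 1) = fls_X * q_real x + 1" for x by (rule q_real_plus_1)
  fix x :: real
  assume "x \<noteq> 0"
  note rel = q_real_inverse[OF this]
  \<comment> \<open>The product in \<open>rel\<close> is -1/q, which is nonzero.\<close>
  then show "q_real x \<noteq> 0" by auto
  with rel show "q_real (- (1 / x)) = - (inverse fls_X) * (1 / q_real x)"
    by (metis nonzero_eq_divide_eq times_divide_eq_right mult.right_neutral)
qed

end
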